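(* Let $\mathbb{F}$ be an algebraically closed field of characteristic $p>2$, let $n\in\mathbb{N}$, and let $q\in\mathcal{W}(1;n)$ be invertible in $(\mathcal{W}(1;n),\bullet)$. Then every finite-dimensional irreducible representation of the transposed Poisson algebra $\mathcal{W}_n(q)$ is, up to isomorphism, either (i) the one-dimensional trivial representation, or (ii) a representation of the form $M_q(a)$ for some $a\in\mathcal{W}(1;n)$. Moreover, every representation $M_q(a)$ has dimension $p^n$.
   Context: For $n\geq 1$, the divided powers algebra $\mathcal{O}(1;n)$ over $\mathbb{F}$ is the commutative associative unital algebra with basis $x^{(i)}$, $0\le i<p^n$, and multiplication $x^{(i)}x^{(j)}=\binom{i+j}{j}x^{(i+j)}$ with $x^{(k)}=0$ for $k\geq p^n$. Let $\partial$ be its derivation with $\partial(x^{(i)})=x^{(i-1)}$ ($\partial(x^{(0)})=0$). The Zassenhaus algebra is $\mathcal{W}(1;n)=\mathcal{O}(1;n)\partial$ with Lie bracket $[f\partial,g\partial]=(f\,\partial(g)-\partial(f)\,g)\partial$. Let $\bullet$ be the commutative associative product on $\mathcal{W}(1;n)$ given by $(f\partial)\bullet(g\partial)=(fg)\partial$, with unit $e_{-1}=\partial$. For $q\in\mathcal{W}(1;n)$, $\mathcal{W}_n(q)$ is the transposed Poisson algebra with underlying space $\mathcal{W}(1;n)$, its Lie bracket, and the associative commutative product $x\bullet_q y=x\bullet q\bullet y$. A representation of a transposed Poisson algebra $(\mathcal{P},\circ,[\cdot,\cdot])$ is a triple $(\alpha,\beta,V)$ where $V$ is a vector space, $\alpha:\mathcal{P}\to\mathrm{End}(V)$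 is linear with $\alpha(x\circ y)=\alpha(x)\alpha(y)$, $\beta:\mathcal{P}\to\mathrm{End}(V)$ is a representation of the Lie algebra $(\mathcal{P},[\cdot,\cdot])$, and for all $x,y\in\mathcal{P}$: $2\alpha(x)\beta(y)=\beta(x\circ y)+\beta(y)\alpha(x)$ and $2\alpha([x,y])=\beta(x)\alpha(y)-\beta(y)\alpha(x)$. A subrepresentation is given by a subspace stable under all $\alpha(x)$ and $\beta(x)$; a representation on $V\neq 0$ is irreducible if $0$ and $V$ are its only subrepresentations. The trivial representation has $\alpha=\beta=0$. Isomorphisms of representations are linear bijections intertwining both $\alpha$ and $\beta$. For $x\in\mathcal{W}(1;n)$ let $P_x(y)=x\bullet y$ and $Q_x(y)=[x,y]$. For $a\in\mathcal{W}(1;n)$, $M_q(a)=(\alpha_q,\beta_a,\mathcal{W}(1;n))$ is the representation of $\mathcal{W}_n(q)$ with $\alpha_q(x)=P_{x\bullet q}$ and $\beta_a(x)=Q_x+P_{x\bullet a}$. *)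

theory Defs
  imports
    "HOL-Computational_Algebra.Computational_Algebra"
    "HOL-Library.Function_Algebras"
begin

section \<open>Transposed Poisson algebras and their representations\<close>

text \<open>
  All vector spaces are carrier sets that are subspaces of an ambient space: a type of class
  \<^class>\<open>ab_group_add\<close> with an explicit scalar multiplication. The ambient type is arbitrary
  and the carrier may be the whole type, so this covers all vector spaces.
\<close>

definition vspace_on :: "('k::field \<Rightarrow> 'v::ab_group_add \<Rightarrow> 'v) \<Rightarrow> 'v set \<Rightarrow> bool" where
  "vspace_on s V \<longleftrightarrow> vector_space s \<and> module.subspace s V"

definition lin_on ::
  "('k::field \<Rightarrow> 'v::ab_group_add \<Rightarrow> 'v) \<Rightarrow> 'v set \<Rightarrow> ('k \<Rightarrow> 'w::ab_group_add \<Rightarrow> 'w) \<Rightarrow> 'w set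
    \<Rightarrow> ('v \<Rightarrow> 'w) \<Rightarrow> bool" where
  "lin_on s V t W f \<longleftrightarrow>
     (\<forall>x\<in>V. f x \<in> W) \<and>
     (\<forall>x\<in>V. \<forall>y\<in>V. f (x + y) = f x + f y) \<and>
     (\<forall>c. \<forall>x\<in>V. f (s c x) = t c (f x))"

record ('k, 'p) tpa =
  tpa_space :: "'p set"
  tpa_scale :: "'k \<Rightarrow> 'p \<Rightarrow> 'p"
  tpa_prod :: "'p \<Rightarrow> 'p \<Rightarrow> 'p"
  tpa_bracket :: "'p \<Rightarrow> 'p \<Rightarrow> 'p"

definition bilin_op_on ::
  "('k::field \<Rightarrow> 'v::ab_group_add \<Rightarrow> 'v) \<Rightarrow> 'v set \<Rightarrow> ('v \<Rightarrow> 'v \<Rightarrow> 'v) \<Rightarrow> bool" where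
  "bilin_op_on s V m \<longleftrightarrow>
     (\<forall>x\<in>V. lin_on s V s V (m x)) \<and> (\<forall>y\<in>V. lin_on s V s V (\<lambda>x. m x y))"

definition transposed_poisson_algebra :: "('k::field, 'p::ab_group_add) tpa \<Rightarrow> bool" where
  "transposed_poisson_algebra A \<longleftrightarrow>
    (let P = tpa_space A; s = tpa_scale A; m = tpa_prod A; br = tpa_bracket A in
     vspace_on s P \<and> bilin_op_on s P m \<and> bilin_op_on s P br \<and>
     (\<forall>x\<in>P. \<forall>y\<in>P. m x y = m y x) \<and>
     (\<forall>x\<in>P. \<forall>y\<in>P. \<forall>z\<in>P. m (m x y) z = m x (m y z)) \<and>
     (\<forall>x\<in>P. br x x = 0) \<and>
     (\<forall>x\<in>P. \<forall>y\<in>P. \<forall>z\<in>P. br x (br y z) + br y (br z x) + br z (br x y) = 0) \<and>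
     (\<forall>x\<in>P. \<forall>y\<in>P. \<forall>z\<in>P. s 2 (m z (br x y)) = br (m z x) y + br x (m z y)))"

record ('k, 'p, 'v) repn =
  rep_space :: "'v set"
  rep_scale :: "'k \<Rightarrow> 'v \<Rightarrow> 'v"
  rep_alpha :: "'p \<Rightarrow> 'v \<Rightarrow> 'v"
  rep_beta :: "'p \<Rightarrow> 'v \<Rightarrow> 'v"

text \<open>A linear map into the endomorphisms of \<open>V\<close>; only its values on \<open>P\<close> and \<open>V\<close> matter.\<close>

definition lin_action ::
  "('k::field, 'p::ab_group_add) tpa \<Rightarrow> ('k \<Rightarrow> 'v::ab_group_add \<Rightarrow> 'v) \<Rightarrow> 'v set
    \<Rightarrow> ('p \<Rightarrow> 'v \<Rightarrow> 'v) \<Rightarrow> bool" where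
  "lin_action A s V g \<longleftrightarrow>
     (\<forall>x\<in>tpa_space A. lin_on s V s V (g x)) \<and>
     (\<forall>v\<in>V. lin_on (tpa_scale A) (tpa_space A) s V (\<lambda>x. g x v))"

definition is_rep ::
  "('k::field, 'p::ab_group_add) tpa \<Rightarrow> ('k, 'p, 'v::ab_group_add) repn \<Rightarrow> bool" where
  "is_rep A R \<longleftrightarrow>
    (let P = tpa_space A; m = tpa_prod A; br = tpa_bracket A;
         V = rep_space R; s = rep_scale R; \<alpha> = rep_alpha R; \<beta> = rep_beta R in
     vspace_on s V \<and> lin_action A s V \<alpha> \<and> lin_action A s V \<beta> \<and>
     (\<forall>x\<in>P. \<forall>y\<in>P. \<forall>v\<in>V.
        \<alpha> (m x y) v = \<alpha> x (\<alpha> y v) \<and>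
        \<beta> (br x y) v = \<beta> x (\<beta> y v) - \<beta> y (\<beta> x v) \<and>
        s 2 (\<alpha> x (\<beta> y v)) = \<beta> (m x y) v + \<beta> y (\<alpha> x v) \<and>
        s 2 (\<alpha> (br x y) v) = \<beta> x (\<alpha> y v) - \<beta> y (\<alpha> x v)))"

definition is_subrep ::
  "('k::field, 'p::ab_group_add) tpa \<Rightarrow> ('k, 'p, 'v::ab_group_add) repn \<Rightarrow> 'v set \<Rightarrow> bool" where
  "is_subrep A R U \<longleftrightarrow>
     U \<subseteq> rep_space R \<and> module.subspace (rep_scale R) U \<and>
     (\<forall>x\<in>tpa_space A. \<forall>u\<in>U. rep_alpha R x u \<in> U \<and> rep_beta R x u \<in> U)"

definition irreducible_rep ::
  "('k::field, 'p::ab_group_add) tpa \<Rightarrow> ('k, 'p, 'v::ab_group_add) repn \<Rightarrow> bool" where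
  "irreducible_rep A R \<longleftrightarrow>
     is_rep A R \<and> rep_space R \<noteq> {0} \<and>
     (\<forall>U. is_subrep A R U \<longrightarrow> U = {0} \<or> U = rep_space R)"

definition fin_dim_rep :: "('k::field, 'p, 'v::ab_group_add) repn \<Rightarrow> bool" where
  "fin_dim_rep R \<longleftrightarrow> (\<exists>B. finite B \<and> module.span (rep_scale R) B = rep_space R)"

definition rep_dim :: "('k::field, 'p, 'v::ab_group_add) repn \<Rightarrow> nat" where
  "rep_dim R = vector_space.dim (rep_scale R) (rep_space R)"

definition rep_iso ::
  "('k::field, 'p::ab_group_add) tpa \<Rightarrow> ('k, 'p, 'v::ab_group_add) repn
    \<Rightarrow> ('k, 'p, 'w::ab_group_add) repn \<Rightarrow> bool" where
  "rep_iso A R S \<longleftrightarrow>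
     (\<exists>\<phi>. bij_betw \<phi> (rep_space R) (rep_space S) \<and>
          lin_on (rep_scale R) (rep_space R) (rep_scale S) (rep_space S) \<phi> \<and>
          (\<forall>x\<in>tpa_space A. \<forall>v\<in>rep_space R.
             \<phi> (rep_alpha R x v) = rep_alpha S x (\<phi> v) \<and>
             \<phi> (rep_beta R x v) = rep_beta S x (\<phi> v)))"

definition trivial_rep_1 :: "('k::field, 'p, 'k) repn" where
  "trivial_rep_1 =
     \<lparr>rep_space = UNIV, rep_scale = (*), rep_alpha = (\<lambda>x v. 0), rep_beta = (\<lambda>x v. 0)\<rparr>"

section \<open>Divided powers and Zassenhaus algebras\<close>

text \<open>
  An element of \<open>\<O>(1;n)\<close> is its family of coordinates in the basis \<open>x\<^sup>(\<^sup>i\<^sup>)\<close>, \<open>0 \<le> i < p\<^sup>n\<close>, where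
  \<open>p\<close> is the characteristic of the field, continued by 0 to all of \<^typ>\<open>nat\<close>. An element \<open>f\<partial>\<close> of
  \<open>\<W>(1;n)\<close> is represented by \<open>f\<close>, so that \<open>\<bullet>\<close> becomes the product of \<open>\<O>(1;n)\<close> and its unit
  \<open>\<partial>\<close> becomes \<open>x\<^sup>(\<^sup>0\<^sup>)\<close>.
\<close>

type_synonym 'k dp = "nat \<Rightarrow> 'k"

definition dp_space :: "nat \<Rightarrow> 'k::field dp set" where
  "dp_space n = {f. \<forall>i \<ge> CHAR('k) ^ n. f i = 0}"

definition dp_scale :: "'k::field \<Rightarrow> 'k dp \<Rightarrow> 'k dp" where
  "dp_scale c f = (\<lambda>i. c * f i)"

definition dp_basis :: "nat \<Rightarrow> nat \<Rightarrow> 'k::field dp" where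
  "dp_basis n k = (\<lambda>i. if i = k \<and> k < CHAR('k) ^ n then 1 else 0)"

definition dp_mult :: "nat \<Rightarrow> 'k::field dp \<Rightarrow> 'k dp \<Rightarrow> 'k dp" where
  "dp_mult n f g =
     (\<Sum>i < CHAR('k) ^ n. \<Sum>j < CHAR('k) ^ n.
        dp_scale (f i * g j * of_nat ((i + j) choose j)) (dp_basis n (i + j)))"

text \<open>The derivation with \<open>x\<^sup>(\<^sup>i\<^sup>) \<mapsto> x\<^sup>(\<^sup>i\<^sup>-\<^sup>1\<^sup>)\<close> and \<open>x\<^sup>(\<^sup>0\<^sup>) \<mapsto> 0\<close> shifts the coordinates.\<close>

definition dp_deriv :: "'k::field dp \<Rightarrow> 'k dp" where
  "dp_deriv f = (\<lambda>i. f (Suc i))"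

definition zass_bracket :: "nat \<Rightarrow> 'k::field dp \<Rightarrow> 'k dp \<Rightarrow> 'k dp" where
  "zass_bracket n f g = dp_mult n f (dp_deriv g) - dp_mult n (dp_deriv f) g"

definition dp_invertible :: "nat \<Rightarrow> 'k::field dp \<Rightarrow> bool" where
  "dp_invertible n q \<longleftrightarrow> (\<exists>r\<in>dp_space n. dp_mult n q r = dp_basis n 0)"

definition zass_tpa :: "nat \<Rightarrow> 'k::field dp \<Rightarrow> ('k, 'k dp) tpa" where
  "zass_tpa n q =
     \<lparr>tpa_space = dp_space n, tpa_scale = dp_scale,
      tpa_prod = (\<lambda>x y. dp_mult n (dp_mult n x q) y), tpa_bracket = zass_bracket n\<rparr>"

definition zass_rep :: "nat \<Rightarrow> 'k::field dp \<Rightarrow> 'k dp \<Rightarrow> ('k, 'k dp, 'k dp) repn" where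
  "zass_rep n q a =
     \<lparr>rep_space = dp_space n, rep_scale = dp_scale,
      rep_alpha = (\<lambda>x. dp_mult n (dp_mult n x q)),
      rep_beta = (\<lambda>x y. zass_bracket n x y + dp_mult n (dp_mult n x a) y)\<rparr>"

section \<open>Well-definedness\<close>

lemma sum_fun_apply: "(\<Sum>i\<in>A. f i) k = (\<Sum>i\<in>A. (f i k :: 'a::comm_monoid_add))"
  by (induction A rule: infinite_finite_induct) auto

lemma dp_mult_basis:
  assumes "i < CHAR('k::field) ^ n" "j < CHAR('k) ^ n"
  shows "dp_mult n (dp_basis n i) (dp_basis n j) =
           dp_scale (of_nat ((i + j) choose j)) (dp_basis n (i + j) :: 'k dp)"
proof -
  have "dp_mult n (dp_basis n i) (dp_basis n j :: 'k dp) =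
     (\<Sum>i' < CHAR('k) ^ n. \<Sum>j' < CHAR('k) ^ n. if j' = j then (if i' = i then
        dp_scale (of_nat ((i' + j') choose j')) (dp_basis n (i' + j')) else 0) else 0)"
    unfolding dp_mult_def using assms
    by (intro sum.cong refl) (auto simp: dp_basis_def dp_scale_def fun_eq_iff)
  also have "\<dots> = dp_scale (of_nat ((i + j) choose j)) (dp_basis n (i + j))"
    using assms by (simp add: sum.delta)
  finally show ?thesis .
qed

lemma dp_deriv_basis:
  assumes "k < CHAR('k::field) ^ n"
  shows "dp_deriv (dp_basis n k :: 'k dp) = (if k = 0 then 0 else dp_basis n (k - 1))"
  using assms by (auto simp: dp_deriv_def dp_basis_def fun_eq_iff)

lemma dp_mult_nth:
  "dp_mult n f g k =
     (if k < CHAR('k::field) ^ n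
      then \<Sum>i\<le>k. of_nat (k choose i) * f i * (g (k - i) :: 'k) else 0)"
proof (cases "k < CHAR('k) ^ n")
  case True
  let ?N = "CHAR('k) ^ n"
  have "dp_mult n f g k =
     (\<Sum>i<?N. \<Sum>j<?N. if i + j = k then f i * g j * of_nat ((i + j) choose j) else 0)"
    unfolding dp_mult_def using True
    by (simp add: sum_fun_apply dp_scale_def dp_basis_def if_distrib cong: if_cong)
       (intro sum.cong refl, auto)
  also have "\<dots> = (\<Sum>i<?N. if i \<le> k then of_nat (k choose i) * f i * g (k - i) else 0)"
  proof (intro sum.cong refl)
    fix i
    have "(\<Sum>j<?N. if i + j = k then f i * g j * of_nat ((i + j) choose j) else 0) =
          (\<Sum>j<?N. if j = k - i then (if i \<le> k then of_nat (k choose i) * f i * g (k - i) else 0)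
             else (0::'k))"
      using less_imp_diff_less[OF True, of i]
      by (intro sum.cong refl) (auto simp: binomial_symmetric[of i])
    also have "\<dots> = (if i \<le> k then of_nat (k choose i) * f i * g (k - i) else 0)"
      using less_imp_diff_less[OF True, of i] by simp
    finally show "(\<Sum>j<?N. if i + j = k then f i * g j * of_nat ((i + j) choose j) else 0) = \<dots>" .
  qed
  also have "\<dots> = (\<Sum>i\<in>{i\<in>{..<?N}. i \<le> k}. of_nat (k choose i) * f i * g (k - i))"
    by (rule sum.inter_filter[symmetric]) simp
  also have "{i\<in>{..<?N}. i \<le> k} = {..k}"
    using True by auto
  finally show ?thesis
    using True by simp
next
  case False
  then show ?thesis
    by (auto simp: dp_mult_def sum_fun_apply dp_scale_def dp_basis_def intro!: sum.neutral)
qed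

lemma dp_mult_in [simp]: "dp_mult n f g \<in> dp_space n"
  by (simp add: dp_space_def dp_mult_nth)

lemma dp_mult_comm: "dp_mult n f g = dp_mult n g f"
proof
  fix k
  have "(\<Sum>i\<le>k. of_nat (k choose i) * f i * g (k - i)) =
        (\<Sum>i\<le>k. of_nat (k choose i) * g i * (f (k - i) :: 'a))"
    by (rule sum.reindex_bij_witness[of _ "\<lambda>i. k - i" "\<lambda>i. k - i"])
       (auto simp: binomial_symmetric[symmetric])
  then show "dp_mult n f g k = dp_mult n g f k"
    by (simp add: dp_mult_nth)
qed

lemma dp_mult_assoc: "dp_mult n (dp_mult n f g) h = dp_mult n f (dp_mult n g h)"
proof
  fix k
  have "(\<Sum>i\<le>k. \<Sum>j\<le>i. of_nat (k choose i) * (of_nat (i choose j) * f j * g (i - j)) * h (k - i)) =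
        (\<Sum>i\<le>k. \<Sum>j\<le>k - i. of_nat (k choose i) * f i *
            (of_nat ((k - i) choose j) * g j * (h (k - i - j) :: 'a)))"
    unfolding sum.Sigma[OF finite_atMost ballI[OF finite_atMost]]
  proof (rule sum.reindex_bij_witness[of _ "\<lambda>(i, j). (i + j, i)" "\<lambda>(i, j). (j, i - j)"], goal_cases)
    case (5 x)
    then obtain i j where x: "x = (i, j)" "j \<le> i" "i \<le> k" by auto
    have "(k choose i) * (i choose j) = (k choose j) * ((k - j) choose (i - j))"
      by (rule choose_mult) (use x in auto)
    then have "of_nat (k choose i) * of_nat (i choose j) =
               of_nat (k choose j) * (of_nat ((k - j) choose (i - j)) :: 'a)"
      by (metis of_nat_mult)
    then show ?case
      using x by (simp add: mult_ac)
  qed auto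
  then show "dp_mult n (dp_mult n f g) h k = dp_mult n f (dp_mult n g h) k"
    by (simp add: dp_mult_nth sum_distrib_left sum_distrib_right mult.assoc less_imp_diff_less
        cong: if_cong)
qed

lemma dp_mult_left_comm: "dp_mult n f (dp_mult n g h) = dp_mult n g (dp_mult n f h)"
  by (metis dp_mult_assoc dp_mult_comm)

lemmas dp_mult_ac = dp_mult_assoc dp_mult_comm dp_mult_left_comm

lemma dp_mult_linear:
  "dp_mult n f (g + h) = dp_mult n f g + dp_mult n f h"
  "dp_mult n (f + g) h = dp_mult n f h + dp_mult n g h"
  "dp_mult n f (g - h) = dp_mult n f g - dp_mult n f h"
  "dp_mult n (f - g) h = dp_mult n f h - dp_mult n g h"
  "dp_mult n f (dp_scale c g) = dp_scale c (dp_mult n f g)"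
  "dp_mult n (dp_scale c f) g = dp_scale c (dp_mult n f g)"
  by (auto simp: fun_eq_iff dp_mult_nth dp_scale_def algebra_simps sum.distrib sum_subtractf
        sum_distrib_left)

lemma dp_deriv_linear:
  "dp_deriv (f + g) = dp_deriv f + dp_deriv g"
  "dp_deriv (f - g) = dp_deriv f - dp_deriv g"
  "dp_deriv (dp_scale c f) = dp_scale c (dp_deriv f)"
  by (auto simp: dp_deriv_def dp_scale_def)

lemma dp_scale_linear:
  "dp_scale c (f + g) = dp_scale c f + dp_scale c g"
  "dp_scale c (f - g) = dp_scale c f - dp_scale c g"
  "dp_scale 2 f = f + f"
  by (auto simp: dp_scale_def algebra_simps)

lemma dp_space_closed [simp]:
  "0 \<in> dp_space n"
  "f \<in> dp_space n \<Longrightarrow> g \<in> dp_space n \<Longrightarrow> f + g \<in> dp_space n"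
  "f \<in> dp_space n \<Longrightarrow> g \<in> dp_space n \<Longrightarrow> f - g \<in> dp_space n"
  "f \<in> dp_space n \<Longrightarrow> dp_scale c f \<in> dp_space n"
  "f \<in> dp_space n \<Longrightarrow> dp_deriv f \<in> dp_space n"
  by (auto simp: dp_space_def dp_scale_def dp_deriv_def)

lemma dp_mult_unit:
  assumes "f \<in> dp_space n"
  shows "dp_mult n (dp_basis n 0) f = f"
proof
  fix k
  have "(\<Sum>i\<le>k. of_nat (k choose i) * dp_basis n 0 i * f (k - i)) =
        (\<Sum>i\<le>k. if i = 0 then f k else 0)" if "k < CHAR('a) ^ n"
    by (intro sum.cong refl) (use that in \<open>auto simp: dp_basis_def zero_power\<close>)
  then show "dp_mult n (dp_basis n 0) f k = f k"
    using assms by (auto simp: dp_mult_nth dp_space_def)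
qed

lemma prime_dvd_choose_prime_power:
  assumes "prime (p::nat)" "0 < i" "i < p ^ n"
  shows "p dvd (p ^ n choose i)"
proof (rule ccontr)
  assume "\<not> p dvd (p ^ n choose i)"
  then have "coprime (p ^ n) (p ^ n choose i)"
    using assms(1) by (simp add: prime_imp_coprime)
  moreover have "p ^ n dvd i * (p ^ n choose i)"
    using binomial_absorption[of "i - 1" "p ^ n"] assms(2) by simp
  ultimately have "p ^ n dvd i"
    by (simp add: coprime_dvd_mult_left_iff)
  then show False
    using assms by (auto dest: dvd_imp_le)
qed

lemma dp_deriv_mult:
  fixes f g :: "'k::field dp"
  assumes p: "CHAR('k) > 0" and f: "f \<in> dp_space n" and g: "g \<in> dp_space n"
  shows "dp_deriv (dp_mult n f g) = dp_mult n (dp_deriv f) g + dp_mult n f (dp_deriv g)"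
proof
  fix k
  let ?N = "CHAR('k) ^ n"
  define T where "T = (\<Sum>i\<le>Suc k. of_nat (Suc k choose i) * f i * g (Suc k - i))"
  have pr: "prime CHAR('k)"
    using p by (rule prime_CHAR_semidom)
  have "T = f 0 * g (Suc k) + (\<Sum>i\<le>k. of_nat (k choose Suc i) * f (Suc i) * g (k - i)) +
              (\<Sum>i\<le>k. of_nat (k choose i) * f (Suc i) * g (k - i))"
    unfolding T_def by (subst sum.atMost_Suc_shift) (simp add: algebra_simps sum.distrib)
  also have "f 0 * g (Suc k) + (\<Sum>i\<le>k. of_nat (k choose Suc i) * f (Suc i) * g (k - i)) =
      (\<Sum>i\<le>Suc k. of_nat (k choose i) * f i * g (Suc k - i))"
    by (subst sum.atMost_Suc_shift) (simp add: binomial_eq_0)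
  also have "\<dots> = (\<Sum>i\<le>k. of_nat (k choose i) * f i * g (Suc (k - i)))"
    by (simp add: Suc_diff_le binomial_eq_0)
  finally have T: "T = (\<Sum>i\<le>k. of_nat (k choose i) * f i * g (Suc (k - i))) +
      (\<Sum>i\<le>k. of_nat (k choose i) * f (Suc i) * g (k - i))" .
  consider "Suc k < ?N" | "Suc k = ?N" | "k \<ge> ?N" by linarith
  then show "dp_deriv (dp_mult n f g) k = (dp_mult n (dp_deriv f) g + dp_mult n f (dp_deriv g)) k"
  proof cases
    case 1
    then have "dp_deriv (dp_mult n f g) k = T"
      by (simp add: dp_deriv_def dp_mult_nth T_def del: sum.atMost_Suc)
    then show ?thesis
      using 1 by (simp add: T dp_mult_nth dp_deriv_def)
  next
    case 2
    have "T = 0"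
      unfolding T_def
    proof (intro sum.neutral ballI)
      fix i assume i: "i \<in> {..Suc k}"
      consider "i = 0" | "i = ?N" | "0 < i" "i < ?N"
        using i 2 by fastforce
      then show "of_nat (Suc k choose i) * f i * g (Suc k - i) = 0"
      proof cases
        case 1
        then show ?thesis using g 2 by (simp add: dp_space_def)
      next
        case 3
        then have "CHAR('k) dvd (?N choose i)"
          by (rule prime_dvd_choose_prime_power[OF pr])
        then show ?thesis using 2 by (simp add: of_nat_eq_0_iff_char_dvd)
      qed (use f 2 in \<open>simp add: dp_space_def\<close>)
    qed
    moreover have "k < ?N" using 2 by simp
    ultimately show ?thesis
      using 2 T by (simp add: dp_mult_nth dp_deriv_def add.commute)
  qed (auto simp: dp_mult_nth dp_deriv_def)
qed

lemma vspace_on_dp: "vspace_on dp_scale (dp_space n)"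
proof -
  interpret vector_space "dp_scale :: 'a \<Rightarrow> _"
    by unfold_locales (auto simp: dp_scale_def algebra_simps)
  show ?thesis
    by (auto simp: vspace_on_def subspace_def intro: vector_space_axioms)
qed

lemma zass_bracket_in [simp]:
  "f \<in> dp_space n \<Longrightarrow> g \<in> dp_space n \<Longrightarrow> zass_bracket n f g \<in> dp_space n"
  by (simp add: zass_bracket_def)

lemma zass_tpa_transposed_poisson:
  fixes q :: "'k::field dp"
  assumes "CHAR('k) > 0" "q \<in> dp_space n"
  shows "transposed_poisson_algebra (zass_tpa n q)"
  unfolding transposed_poisson_algebra_def zass_tpa_def Let_def bilin_op_on_def lin_on_def
  using assms
  by (auto simp: vspace_on_dp zass_bracket_def dp_mult_linear dp_deriv_linear dp_scale_linear
        dp_deriv_mult dp_mult_ac)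

lemma zass_rep_is_rep:
  fixes q :: "'k::field dp"
  assumes "CHAR('k) > 0" "q \<in> dp_space n" "a \<in> dp_space n"
  shows "is_rep (zass_tpa n q) (zass_rep n q a)"
  unfolding is_rep_def zass_tpa_def zass_rep_def Let_def lin_action_def lin_on_def
  using assms
  by (auto simp: vspace_on_dp zass_bracket_def dp_mult_linear dp_deriv_linear dp_scale_linear
        dp_deriv_mult dp_mult_ac)

end

theory Submission
  imports Defs
begin

text \<open>
  Let \<open>r\<close> be the inverse of \<open>q\<close>. Then \<open>\<alpha>(r)\<close> is an idempotent with \<open>\<beta>(y) = \<beta>(y) \<alpha>(r)\<close>, so on an
  irreducible module it is \<open>0\<close> (the trivial case) or \<open>1\<close>. In the second case \<open>A(f) = \<alpha>(fr)\<close> makes \<open>V\<close> a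
  unital \<open>\<O>(1;n)\<close>-module, and \<open>B = \<beta>(\<partial>)\<close> satisfies \<open>[B, A(f)] = A(f')\<close> and
  \<open>\<beta>(x) = A(x) B - A(x')\<close>.

  Put \<open>N = p\<^sup>n\<close>. The vectors killed by the maximal ideal form a nonzero subspace stable under \<open>B\<^sup>N\<close>;
  let \<open>v\<close> be an eigenvector of \<open>B\<^sup>N\<close> in it and \<open>w = B\<^bsup>N-1\<^esup> v\<close>. Because
  \<open>binomial(N-1, k) = (-1)\<^sup>k\<close> modulo \<open>p\<close>, \<open>A(x\<^bsup>(k)\<^esup>) w = B\<^bsup>N-1-k\<^esup> v\<close>, so \<open>B w = B\<^sup>N v = A(a) w\<close> with \<open>a\<close> a multiple
  of \<open>x\<^bsup>(N-1)\<^esup>\<close>. Hence \<open>f \<mapsto> A(f) w\<close> has a submodule as its image and a derivation-stable kernel, and it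
  is an isomorphism from \<open>M\<^sub>q(a)\<close> onto \<open>V\<close>.
\<close>

section \<open>Eigenvectors on finite-dimensional subspaces\<close>

text \<open>Among the nonzero polynomials P with P(T) v = 0 take one of least degree. It has a root
  c, and if P = (X - c) Q then Q(T) v is the eigenvector. Closedness is the hypothesis
  \<open>alg\<close> because the scalars of \<open>vector_space\<close> form an arbitrary
  field.\<close>

lemma (in vector_space) eigenvector_exists:
  fixes T :: "'b \<Rightarrow> 'b"
  assumes alg: "\<And>p :: 'a poly. degree p > 0 \<Longrightarrow> \<exists>c. poly p c = 0"
    and K: "subspace K" "K \<subseteq> span F" "finite F"
    and T: "\<And>x. x \<in> K \<Longrightarrow> T x \<in> K"
    and T_add: "\<And>x y. x \<in> K \<Longrightarrow> y \<in> K \<Longrightarrow> T (x + y) = T x + T y"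
    and T_scale: "\<And>c x. x \<in> K \<Longrightarrow> T (c *s x) = c *s T x"
    and v: "v \<in> K" "v \<noteq> 0"
  obtains u c where "u \<in> K" "u \<noteq> 0" "T u = c *s u"
proof -
  define t where "t i = (T ^^ i) v" for i
  have t_K: "t i \<in> K" for i
    by (induction i) (simp_all add: t_def v T)
  have t_Suc: "t (Suc i) = T (t i)" for i
    by (simp add: t_def)
  \<comment> \<open>This is P(T) v once m is at least the degree of P. The free bound m lets P and
    (X - c) P be compared without computing degrees.\<close>
  define ev where "ev m P = (\<Sum>i\<le>m. coeff P i *s t i)" for m and P :: "'a poly"
  have ev_K: "ev m P \<in> K" for m P
    unfolding ev_def by (intro subspace_sum K subspace_scale t_K)
  have T_sum: "T (\<Sum>i\<le>m. d i *s t i) = (\<Sum>i\<le>m. d i *s t (Suc i))" for d m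
  proof (induction m)
    case (Suc m)
    have "(\<Sum>i\<le>m. d i *s t i) \<in> K"
      by (intro subspace_sum K subspace_scale t_K)
    with Suc show ?case
      using t_K[of "Suc m"] by (simp add: T_add T_scale t_Suc[symmetric] K subspace_scale)
  qed (simp add: T_scale t_K t_Suc)
  have ev_degree: "ev m P = ev (degree P) P" if "degree P \<le> m" for m P
    unfolding ev_def using that
    by (intro sum.mono_neutral_right) (auto simp: coeff_eq_0)
  \<comment> \<open>Multiplication by X shifts coefficients, which amounts to applying T. The extra
    index m + 1 adds nothing to the c-part because \<open>degree P \<le> m\<close>.\<close>
  have ev_root: "ev (Suc m) ([:-c, 1:] * P) = T (ev m P) - c *s ev m P" if "degree P \<le> m" for c m P
  proof -
    have "ev (Suc m) ([:-c, 1:] * P) =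
        (\<Sum>i\<le>Suc m. coeff (pCons 0 P) i *s t i) - (\<Sum>i\<le>Suc m. (c * coeff P i) *s t i)"
      unfolding ev_def by (simp add: sum_subtractf[symmetric] algebra_simps del: sum.atMost_Suc)
    also have "(\<Sum>i\<le>Suc m. coeff (pCons 0 P) i *s t i) = T (ev m P)"
      by (subst sum.atMost_Suc_shift) (simp add: ev_def T_sum)
    also have "(\<Sum>i\<le>Suc m. (c * coeff P i) *s t i) = c *s ev m P"
      using that by (simp add: ev_def scale_sum_right coeff_eq_0)
    finally show ?thesis .
  qed
  \<comment> \<open>Dependence is a property of sets and does not see repetitions. So distinct
    iterates yield P from a linear dependence among \<open>card F + 1\<close> vectors, and a
    repetition yields P = X^j - X^i.\<close>
  have "\<exists>P. P \<noteq> 0 \<and> ev (degree P) P = 0"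
  proof (cases "inj t")
    case True
    have "dependent (t ` {..card F})"
    proof (rule ccontr)
      assume "independent (t ` {..card F})"
      moreover have "t ` {..card F} \<subseteq> span F"
        using t_K K by auto
      ultimately have "card (t ` {..card F}) \<le> card F"
        using independent_span_bound K(3) by blast
      then show False
        using True by (simp add: card_image inj_on_subset)
    qed
    then obtain d where d: "\<exists>x\<in>t ` {..card F}. d x \<noteq> 0"
        "(\<Sum>x\<in>t ` {..card F}. d x *s x) = 0"
      by (auto simp: dependent_finite)
    define P where "P = (\<Sum>i\<le>card F. monom (d (t i)) i)"
    have coeff_P: "coeff P i = (if i \<le> card F then d (t i) else 0)" for i
      by (simp add: P_def coeff_sum)
    have "degree P \<le> card F"
      by (rule degree_le) (simp add: coeff_P)
    moreover have "ev (card F) P = 0"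
      using d(2) by (simp add: ev_def coeff_P sum.reindex[OF inj_on_subset[OF True subset_UNIV]])
    ultimately have "ev (degree P) P = 0"
      using ev_degree[of P "card F"] by simp
    moreover have "P \<noteq> 0"
      using d(1) coeff_P by (metis atMost_iff coeff_0 imageE)
    ultimately show ?thesis by blast
  next
    case False
    then obtain i j where ij: "i < j" "t i = t j"
      by (metis injI linorder_neqE_nat)
    define P :: "'a poly" where "P = monom 1 j - monom 1 i"
    have deg: "degree P \<le> j"
      by (rule degree_le) (use ij in \<open>simp add: P_def\<close>)
    have "ev j P = (\<Sum>k\<le>j. (if k = j then t k else 0) - (if k = i then t k else 0))"
      unfolding ev_def by (intro sum.cong refl) (use ij in \<open>auto simp: P_def\<close>)
    also have "\<dots> = t j - t i"
      using ij by (simp add: sum_subtractf)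
    finally have "ev (degree P) P = 0"
      using ij ev_degree[OF deg] by simp
    moreover have "coeff P j \<noteq> 0"
      using ij by (simp add: P_def)
    then have "P \<noteq> 0"
      by (metis coeff_0)
    ultimately show ?thesis by blast
  qed
  then obtain P0 where "P0 \<noteq> 0 \<and> ev (degree P0) P0 = 0" ..
  from ex_has_least_nat[of "\<lambda>P. P \<noteq> 0 \<and> ev (degree P) P = 0", OF this, of degree]
  obtain P where P: "P \<noteq> 0" "ev (degree P) P = 0"
    and minimal: "\<And>Q. Q \<noteq> 0 \<Longrightarrow> ev (degree Q) Q = 0 \<Longrightarrow> degree P \<le> degree Q"
    by auto
  have "degree P > 0"
  proof (rule ccontr)
    assume *: "\<not> degree P > 0"
    then have "coeff P 0 \<noteq> 0"
      using P(1) leading_coeff_neq_0[of P] by simp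
    then show False
      using P(2) * v by (simp add: ev_def t_def)
  qed
  then obtain c where "poly P c = 0"
    using alg by blast
  then obtain Q where Q: "P = [:-c, 1:] * Q"
    by (auto simp: poly_eq_0_iff_dvd dvd_def)
  with P(1) have "Q \<noteq> 0" by auto
  have deg: "degree P = Suc (degree Q)"
    unfolding Q using \<open>Q \<noteq> 0\<close> by (subst degree_mult_eq) auto
  have "ev (degree Q) Q \<noteq> 0"
    using minimal[OF \<open>Q \<noteq> 0\<close>] deg by linarith
  moreover have "T (ev (degree Q) Q) = c *s ev (degree Q) Q"
    using P(2) ev_root[of Q "degree Q" c, folded Q] by (simp add: deg)
  ultimately show thesis
    using that ev_K by blast
qed

section \<open>Dimension and binomial coefficients of the divided powers algebra\<close>

lemma dp_vector_space: "vector_space (dp_scale :: 'k::field \<Rightarrow> _)"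
  using vspace_on_dp by (auto simp: vspace_on_def)

lemma dp_space_dim:
  assumes "CHAR('k::field) > 0"
  shows "vector_space.dim dp_scale (dp_space n :: 'k dp set) = CHAR('k) ^ n"
proof -
  interpret dp: vector_space "dp_scale :: 'k \<Rightarrow> _"
    by (rule dp_vector_space)
  let ?N = "CHAR('k) ^ n"
  let ?b = "dp_basis n :: nat \<Rightarrow> 'k dp"
  have inj: "inj_on ?b {..<?N}"
    by (rule inj_onI) (metis dp_basis_def lessThan_iff zero_neq_one)
  have coord: "(\<Sum>i<?N. dp_scale (d i) (?b i)) j = (if j < ?N then d j else 0)" for d j
  proof -
    have "(\<Sum>i<?N. dp_scale (d i) (?b i)) j = (\<Sum>i<?N. if i = j then d i else 0)"
      by (simp only: sum_fun_apply) (intro sum.cong refl, auto simp: dp_scale_def dp_basis_def)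
    then show ?thesis by simp
  qed
  have "dp.independent (?b ` {..<?N})"
  proof
    assume "dp.dependent (?b ` {..<?N})"
    then obtain d i where d: "i < ?N" "d (?b i) \<noteq> 0"
        "(\<Sum>x\<in>?b ` {..<?N}. dp_scale (d x) x) = 0"
      by (auto simp: dp.dependent_finite)
    then have "(\<Sum>i<?N. dp_scale (d (?b i)) (?b i)) = 0"
      using inj by (simp add: sum.reindex)
    then show False
      using coord[of "\<lambda>i. d (?b i)" i] d by simp
  qed
  moreover have "dp_space n \<subseteq> dp.span (?b ` {..<?N})"
  proof
    fix f :: "'k dp" assume f: "f \<in> dp_space n"
    then have "f = (\<Sum>i<?N. dp_scale (f i) (?b i))"
      by (auto simp: fun_eq_iff coord dp_space_def)
    also have "\<dots> \<in> dp.span (?b ` {..<?N})"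
      by (intro dp.span_sum dp.span_scale dp.span_base) auto
    finally show "f \<in> dp.span (?b ` {..<?N})" .
  qed
  moreover have "?b ` {..<?N} \<subseteq> dp_space n"
    by (auto simp: dp_basis_def dp_space_def)
  ultimately show ?thesis
    using dp.dim_unique[of "?b ` {..<?N}" "dp_space n" ?N] inj by (simp add: card_image)
qed

lemma dp_basis_in [simp]: "dp_basis n k \<in> dp_space n"
  by (auto simp: dp_basis_def dp_space_def)

lemma dp_basis_eq_0: "k \<ge> CHAR('k) ^ n \<Longrightarrow> dp_basis n k = (0 :: 'k::field dp)"
  by (auto simp: dp_basis_def fun_eq_iff)

text \<open>By Pascal's rule two neighbouring coefficients of row N - 1 add up to an inner
  coefficient of row N, which vanishes modulo p; so the sign alternates from 1.\<close>

lemma choose_prime_power_pred: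
  assumes "CHAR('k::field) > 0" "k < CHAR('k) ^ n"
  shows "of_nat ((CHAR('k) ^ n - 1) choose k) = ((-1) ^ k :: 'k)"
  using assms(2)
proof (induction k)
  case (Suc k)
  have "CHAR('k) dvd (CHAR('k) ^ n choose Suc k)"
    using prime_CHAR_semidom[OF assms(1)] Suc.prems
    by (intro prime_dvd_choose_prime_power) auto
  then have "(of_nat (CHAR('k) ^ n choose Suc k) :: 'k) = 0"
    by (simp add: of_nat_eq_0_iff_char_dvd)
  moreover have "CHAR('k) ^ n = Suc (CHAR('k) ^ n - 1)"
    using Suc.prems by simp
  ultimately have "(of_nat ((CHAR('k) ^ n - 1) choose k) +
      of_nat ((CHAR('k) ^ n - 1) choose Suc k) :: 'k) = 0"
    by (metis binomial_Suc_Suc of_nat_add)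
  then show ?case
    using Suc by (simp add: add_eq_0_iff)
qed simp

section \<open>Differential modules over the divided powers algebra\<close>

text \<open>What remains of a representation after q is divided out: a unital module A over
  \<O>(1;n) on the carrier V, with a linear B that acts as a connection along the
  derivation.\<close>

locale dp_differential_module = vector_space s
  for s :: "'k::alg_closed_field \<Rightarrow> 'v::ab_group_add \<Rightarrow> 'v" (infixr "*s" 75) +
  fixes n :: nat and V :: "'v set" and A :: "'k dp \<Rightarrow> 'v \<Rightarrow> 'v" and B :: "'v \<Rightarrow> 'v"
  assumes CHAR_pos: "CHAR('k) > 0"
    and V: "subspace V"
    and A_in: "f \<in> dp_space n \<Longrightarrow> v \<in> V \<Longrightarrow> A f v \<in> V"
    and A_add: "f \<in> dp_space n \<Longrightarrow> u \<in> V \<Longrightarrow> v \<in> V \<Longrightarrow> A f (u + v) = A f u + A f v"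
    and A_scale: "f \<in> dp_space n \<Longrightarrow> v \<in> V \<Longrightarrow> A f (c *s v) = c *s A f v"
    and A_add_left: "f \<in> dp_space n \<Longrightarrow> g \<in> dp_space n \<Longrightarrow> v \<in> V \<Longrightarrow> A (f + g) v = A f v + A g v"
    and A_scale_left: "f \<in> dp_space n \<Longrightarrow> v \<in> V \<Longrightarrow> A (dp_scale c f) v = c *s A f v"
    and A_unit: "v \<in> V \<Longrightarrow> A (dp_basis n 0) v = v"
    and A_mult: "f \<in> dp_space n \<Longrightarrow> g \<in> dp_space n \<Longrightarrow> v \<in> V \<Longrightarrow> A (dp_mult n f g) v = A f (A g v)"
    and B_in: "v \<in> V \<Longrightarrow> B v \<in> V"
    and B_add: "u \<in> V \<Longrightarrow> v \<in> V \<Longrightarrow> B (u + v) = B u + B v"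
    and B_scale: "v \<in> V \<Longrightarrow> B (c *s v) = c *s B v"
    and B_A: "f \<in> dp_space n \<Longrightarrow> v \<in> V \<Longrightarrow> B (A f v) = A f (B v) + A (dp_deriv f) v"
begin

lemma B_pow_in: "v \<in> V \<Longrightarrow> (B ^^ i) v \<in> V"
  by (induction i) (simp_all add: B_in)

lemma B_pow_add: "u \<in> V \<Longrightarrow> v \<in> V \<Longrightarrow> (B ^^ i) (u + v) = (B ^^ i) u + (B ^^ i) v"
  by (induction i) (simp_all add: B_add B_pow_in)

lemma B_pow_scale: "v \<in> V \<Longrightarrow> (B ^^ i) (c *s v) = c *s (B ^^ i) v"
  by (induction i) (simp_all add: B_scale B_pow_in)

lemma A_0_left: "v \<in> V \<Longrightarrow> A 0 v = 0"
  using A_add_left[of 0 0 v] by simp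

lemma A_0_right: "f \<in> dp_space n \<Longrightarrow> A f 0 = 0"
  using A_add[of f 0 0] V by (simp add: subspace_0)

lemma B_0: "B 0 = 0"
  using B_add[of 0 0] V by (simp add: subspace_0)

text \<open>The \<open>dp_basis n k\<close> with 0 < k < N span the maximal ideal of the local
  algebra \<O>(1;n), so its annihilator in V is the socle of the module.\<close>

definition socle :: "'v set" where
  "socle = {v \<in> V. \<forall>k. 0 < k \<and> k < CHAR('k) ^ n \<longrightarrow> A (dp_basis n k) v = 0}"

lemma socle_subspace: "subspace socle"
  using V by (auto simp: subspace_def socle_def A_add A_scale A_0_right)

text \<open>For u nonzero take the largest m such that \<open>dp_basis n m\<close> does not kill u.
  Applying \<open>dp_basis n k\<close> with k > 0 to the resulting vector gives a multiple of the
  action of index k + m on u, which is 0 by maximality or because the index reaches N.\<close>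

lemma socle_nonzero:
  assumes "V \<noteq> {0}"
  obtains v where "v \<in> socle" "v \<noteq> 0"
proof -
  obtain u where u: "u \<in> V" "u \<noteq> 0"
    using assms V subspace_0 by blast
  define S where "S = {k. k < CHAR('k) ^ n \<and> A (dp_basis n k) u \<noteq> 0}"
  have S: "finite S" "0 \<in> S"
    using u CHAR_pos by (auto simp: S_def A_unit)
  define m where "m = Max S"
  have "m \<in> S"
    using S Max_in unfolding m_def by blast
  have max: "k \<le> m" if "k \<in> S" for k
    using S that by (simp add: m_def)
  have "A (dp_basis n k) (A (dp_basis n m) u) = 0" if k: "0 < k" "k < CHAR('k) ^ n" for k
  proof -
    have "A (dp_basis n k) (A (dp_basis n m) u) = of_nat ((k + m) choose m) *s A (dp_basis n (k + m)) u"
      using k u \<open>m \<in> S\<close> dp_mult_basis[of k n m, where 'k = 'k]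
      by (simp add: A_mult[symmetric] A_scale_left S_def)
    also have "A (dp_basis n (k + m)) u = 0"
      using max[of "k + m"] k(1) u by (cases "k + m < CHAR('k) ^ n") (auto simp: S_def dp_basis_eq_0 A_0_left)
    finally show ?thesis by simp
  qed
  then show thesis
    using \<open>m \<in> S\<close> u by (intro that[of "A (dp_basis n m) u"]) (auto simp: socle_def S_def A_in)
qed

text \<open>Induction on i: moving one B to the left past \<open>A (dp_basis n k)\<close> costs
  \<open>A (dp_basis n (k - 1))\<close>, and Pascal's rule merges the two terms.\<close>

lemma A_basis_B_pow_socle:
  assumes v: "v \<in> socle" and k: "k < CHAR('k) ^ n"
  shows "A (dp_basis n k) ((B ^^ i) v) = ((-1) ^ k * of_nat (i choose k)) *s (B ^^ (i - k)) v"
  using k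
proof (induction i arbitrary: k)
  case 0
  then show ?case
    using v A_unit[of v] by (cases "k = 0") (auto simp: socle_def binomial_eq_0)
next
  case (Suc i)
  have vV: "v \<in> V"
    using v by (simp add: socle_def)
  show ?case
  proof (cases k)
    case 0
    then show ?thesis
      using A_unit[OF B_pow_in[OF vV]] by (simp del: funpow.simps)
  next
    case [simp]: (Suc j)
    \<comment> \<open>For k > i the subtraction truncates and this identity may fail, but then the
      coefficient \<open>i choose k\<close> is 0.\<close>
    have shift: "B ((B ^^ (i - k)) v) = (B ^^ (i - j)) v" if "k \<le> i"
      using that by (simp add: Suc_diff_Suc flip: funpow_Suc_right funpow.simps(2) comp_apply[of B])
    have "A (dp_basis n k) ((B ^^ Suc i) v) =
        B (A (dp_basis n k) ((B ^^ i) v)) - A (dp_basis n j) ((B ^^ i) v)"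
      using B_A[of "dp_basis n k" "(B ^^ i) v"] Suc.prems by (simp add: B_pow_in vV dp_deriv_basis)
    also have "\<dots> = ((-1) ^ k * of_nat (i choose k)) *s B ((B ^^ (i - k)) v) -
        ((-1) ^ j * of_nat (i choose j)) *s (B ^^ (i - j)) v"
      using Suc.IH[of k] Suc.IH[of j] Suc.prems by (simp add: B_scale B_pow_in vV del: scale_minus_left power_Suc)
    also have "\<dots> = ((-1) ^ k * of_nat (i choose k)) *s (B ^^ (i - j)) v +
        ((-1) ^ k * of_nat (i choose j)) *s (B ^^ (i - j)) v"
      using shift by (cases "k \<le> i") (simp_all add: binomial_eq_0)
    also have "\<dots> = ((-1) ^ k * of_nat (Suc i choose k)) *s (B ^^ (Suc i - k)) v"
      by (simp add: algebra_simps)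
    finally show ?thesis .
  qed
qed

text \<open>In the formula for \<open>A (dp_basis n k)\<close> on powers of B, taken at i = N, the
  binomial coefficients with 0 < k < N are divisible by p.\<close>

lemma socle_B_pow_N:
  assumes v: "v \<in> socle"
  shows "(B ^^ (CHAR('k) ^ n)) v \<in> socle"
proof -
  have "A (dp_basis n k) ((B ^^ (CHAR('k) ^ n)) v) = 0" if "0 < k" "k < CHAR('k) ^ n" for k
  proof -
    have "CHAR('k) dvd (CHAR('k) ^ n choose k)"
      using prime_CHAR_semidom[OF CHAR_pos] that by (rule prime_dvd_choose_prime_power)
    then have "(of_nat (CHAR('k) ^ n choose k) :: 'k) = 0"
      by (simp add: of_nat_eq_0_iff_char_dvd)
    then show ?thesis
      using A_basis_B_pow_socle[OF v that(2), of "CHAR('k) ^ n"] by simp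
  qed
  then show ?thesis
    using v B_pow_in by (auto simp: socle_def)
qed

text \<open>V is free of rank one over \<O>(1;n) on the generator w, and a records B on w.
  Irreducibility makes w generate; stability of its annihilator under the derivation makes it
  free.\<close>

lemma irreducible_structure:
  assumes nz: "V \<noteq> {0}" and fin: "finite F" "V \<subseteq> span F"
    and irred: "\<And>U. U \<subseteq> V \<Longrightarrow> subspace U \<Longrightarrow>
      (\<And>f u. f \<in> dp_space n \<Longrightarrow> u \<in> U \<Longrightarrow> A f u \<in> U) \<Longrightarrow>
      (\<And>u. u \<in> U \<Longrightarrow> B u \<in> U) \<Longrightarrow> U = {0} \<or> U = V"
  obtains a w where "a \<in> dp_space n" "w \<in> V" "B w = A a w" "bij_betw (\<lambda>f. A f w) (dp_space n) V"
proof -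
  obtain v0 where v0: "v0 \<in> socle" "v0 \<noteq> 0"
    using socle_nonzero[OF nz] .
  have "socle \<subseteq> V" by (auto simp: socle_def)
  \<comment> \<open>The power N is taken since B itself need not preserve the socle.\<close>
  obtain v c where v: "v \<in> socle" "v \<noteq> 0" and c: "(B ^^ (CHAR('k) ^ n)) v = c *s v"
  proof (rule eigenvector_exists[of socle F "B ^^ (CHAR('k) ^ n)" v0])
    show "\<exists>c. poly p c = 0" if "degree p > 0" for p :: "'k poly"
      using alg_closed_imp_poly_has_root that by blast
  qed (use v0 fin \<open>socle \<subseteq> V\<close> in \<open>auto simp: socle_subspace socle_B_pow_N intro!: B_pow_add B_pow_scale\<close>)
  have vV: "v \<in> V"
    using v \<open>socle \<subseteq> V\<close> by auto
  have "CHAR('k) ^ n > 0"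
    using CHAR_pos by simp
  \<comment> \<open>The last vector of the chain v, B v, ..., B^(N-1) v generates. The element a is
    scaled so that \<open>A a w\<close> is c v, the value of B on w.\<close>
  define w where "w = (B ^^ (CHAR('k) ^ n - 1)) v"
  define a :: "'k dp" where "a = dp_scale c (dp_basis n (CHAR('k) ^ n - 1))"
  have w: "w \<in> V"
    by (simp add: w_def B_pow_in vV)
  have a: "a \<in> dp_space n"
    by (simp add: a_def)
  \<comment> \<open>The sign (-1)^(N-1) disappears: \<open>choose_prime_power_pred\<close> at k = N
    - 1 equates it with a binomial coefficient equal to 1.\<close>
  have v_eq: "A (dp_basis n (CHAR('k) ^ n - 1)) w = v"
    using A_basis_B_pow_socle[OF v(1), of "CHAR('k) ^ n - 1" "CHAR('k) ^ n - 1"] \<open>CHAR('k) ^ n > 0\<close>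
      choose_prime_power_pred[of "CHAR('k) ^ n - 1" n, where 'k = 'k] CHAR_pos
    by (simp add: w_def)
  have "w \<noteq> 0"
    using v_eq v A_0_right[of "dp_basis n (CHAR('k) ^ n - 1)"] by auto
  have "B w = (B ^^ (CHAR('k) ^ n)) v"
    using \<open>CHAR('k) ^ n > 0\<close> by (simp add: w_def flip: funpow.simps(2) comp_apply[of B])
  then have Bw: "B w = A a w"
    by (simp add: c a_def A_scale_left w v_eq[simplified])
  \<comment> \<open>Under f \<mapsto> \<open>A f w\<close> the operator B becomes f \<mapsto> f a +
    f'.\<close>
  have B_cyclic: "B (A f w) = A (dp_mult n f a + dp_deriv f) w" if "f \<in> dp_space n" for f
    using that by (simp add: B_A w Bw A_add_left A_mult a)
  define U where "U = (\<lambda>f. A f w) ` dp_space n"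
  have "U = {0} \<or> U = V"
  proof (rule irred)
    show "U \<subseteq> V"
      by (auto simp: U_def A_in w)
    show "subspace U"
      unfolding subspace_def U_def
    proof (intro conjI ballI allI; clarsimp?)
      show "0 \<in> (\<lambda>f. A f w) ` dp_space n"
        using A_0_left[OF w] dp_space_closed(1) by (metis image_eqI)
      show "A f w + A g w \<in> (\<lambda>f. A f w) ` dp_space n" if "f \<in> dp_space n" "g \<in> dp_space n" for f g
        using that w by (simp add: A_add_left[symmetric])
      show "d *s A f w \<in> (\<lambda>f. A f w) ` dp_space n" if "f \<in> dp_space n" for d f
        using that w by (simp add: A_scale_left[symmetric])
    qed
    show "A f u \<in> U" if "f \<in> dp_space n" "u \<in> U" for f u
      using that w by (auto simp: U_def A_mult[symmetric])
    show "B u \<in> U" if "u \<in> U" for u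
      using that by (auto simp: U_def B_cyclic a)
  qed
  moreover have "w \<in> U"
    unfolding U_def using A_unit[OF w] by (metis dp_basis_in image_eqI)
  ultimately have "U = V"
    using \<open>w \<noteq> 0\<close> by blast
  \<comment> \<open>If f kills w, so does f a by commutativity, hence also f' by
    \<open>B_cyclic\<close>. Differentiating m times, with m the top index of f, leaves the nonzero
    constant f m, which cannot kill w.\<close>
  have annihilator: "f = 0" if f: "f \<in> dp_space n" "A f w = 0" for f
  proof (rule ccontr)
    assume "f \<noteq> 0"
    have deriv: "(dp_deriv ^^ i) f \<in> dp_space n \<and> A ((dp_deriv ^^ i) f) w = 0" for i
    proof (induction i)
      case (Suc i)
      let ?g = "(dp_deriv ^^ i) f"
      have "A (dp_mult n ?g a) w = A a (A ?g w)"
        using Suc w a by (simp add: dp_mult_comm[of n ?g] A_mult)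
      then show ?case
        using Suc B_cyclic[of ?g] w a by (simp add: B_0 A_0_right A_add_left)
    qed (use f in simp)
    have deriv_nth: "(dp_deriv ^^ i) f j = f (i + j)" for i j
      by (induction i arbitrary: j) (simp_all add: dp_deriv_def)
    define m where "m = Max {i. i < CHAR('k) ^ n \<and> f i \<noteq> 0}"
    have "{i. i < CHAR('k) ^ n \<and> f i \<noteq> 0} \<noteq> {}"
      using \<open>f \<noteq> 0\<close> f(1) by (auto simp: dp_space_def fun_eq_iff not_less)
    then have m: "m < CHAR('k) ^ n" "f m \<noteq> 0"
      using Max_in[of "{i. i < CHAR('k) ^ n \<and> f i \<noteq> 0}"] by (auto simp: m_def)
    have above: "f i = 0" if "i > m" for i
    proof (rule ccontr)
      assume "f i \<noteq> 0"
      then have "i \<in> {i. i < CHAR('k) ^ n \<and> f i \<noteq> 0}"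
        using f(1) by (auto simp: dp_space_def intro: leI)
      then have "i \<le> m"
        unfolding m_def by (intro Max_ge) auto
      with that show False by simp
    qed
    have "(dp_deriv ^^ m) f = dp_scale (f m) (dp_basis n 0)"
      using above \<open>CHAR('k) ^ n > 0\<close> by (auto simp: fun_eq_iff deriv_nth dp_scale_def dp_basis_def)
    then show False
      using deriv[of m] m \<open>w \<noteq> 0\<close> w by (simp add: A_scale_left A_unit)
  qed
  have "inj_on (\<lambda>f. A f w) (dp_space n)"
  proof (rule inj_onI)
    fix f g assume fg: "f \<in> dp_space n" "g \<in> dp_space n" "A f w = A g w"
    then have "A (f - g) w = 0"
      using A_add_left[of "f - g" g w] w by simp
    then have "f - g = 0"
      using annihilator[of "f - g"] fg by simp
    then show "f = g" by simp
  qed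
  then have "bij_betw (\<lambda>f. A f w) (dp_space n) V"
    using \<open>U = V\<close> by (simp add: bij_betw_def U_def)
  then show thesis
    using that a w Bw by blast
qed

end

section \<open>Reduction of representations to differential modules\<close>

text \<open>Irreducibility enters three times: for the kernel of \<open>\<alpha> r\<close>, for a
  line when the action is zero, and through \<open>irreducible_structure\<close> when
  \<open>\<alpha> r\<close> is the identity.\<close>

lemma irreducible_zass_rep:
  fixes R :: "('k::alg_closed_field, 'k dp, 'v::ab_group_add) repn"
  assumes CHAR: "CHAR('k) > 2" and q: "q \<in> dp_space n" "dp_invertible n q"
    and irr: "irreducible_rep (zass_tpa n q) R" and fin: "fin_dim_rep R"
  shows "rep_iso (zass_tpa n q) R trivial_rep_1 \<or>
    (\<exists>a\<in>dp_space n. rep_iso (zass_tpa n q) R (zass_rep n q a))"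
proof -
  define V s \<alpha> \<beta> where defs: "V = rep_space R" "s = rep_scale R" "\<alpha> = rep_alpha R" "\<beta> = rep_beta R"
  obtain r where r: "r \<in> dp_space n" "dp_mult n q r = dp_basis n 0"
    using q by (auto simp: dp_invertible_def)
  have rep: "is_rep (zass_tpa n q) R" and nz: "V \<noteq> {0}"
    and irred: "\<And>U. is_subrep (zass_tpa n q) R U \<Longrightarrow> U = {0} \<or> U = V"
    using irr by (auto simp: irreducible_rep_def defs)
  have vs: "vector_space s" "module.subspace s V"
    using rep by (auto simp: is_rep_def Let_def vspace_on_def defs)
  interpret vector_space s by (rule vs)
  note rep' = rep[unfolded is_rep_def Let_def lin_action_def lin_on_def zass_tpa_def tpa.simps,
      folded defs]
  note linear = rep'[THEN conjunct2, THEN conjunct1] rep'[THEN conjunct2, THEN conjunct2, THEN conjunct1]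
  note relations = rep'[THEN conjunct2, THEN conjunct2, THEN conjunct2]
  have \<alpha>_in: "\<alpha> x v \<in> V" and \<beta>_in: "\<beta> x v \<in> V"
    and \<alpha>_scale: "\<alpha> x (s c v) = s c (\<alpha> x v)" and \<beta>_scale: "\<beta> x (s c v) = s c (\<beta> x v)"
    and \<alpha>_scale_left: "\<alpha> (dp_scale c x) v = s c (\<alpha> x v)"
    if "x \<in> dp_space n" "v \<in> V" for x v c
    using that linear by simp_all
  have \<alpha>_add: "\<alpha> x (u + v) = \<alpha> x u + \<alpha> x v" and \<beta>_add: "\<beta> x (u + v) = \<beta> x u + \<beta> x v"
    if "x \<in> dp_space n" "u \<in> V" "v \<in> V" for x u v
    using that linear by simp_all
  have \<alpha>_add_left: "\<alpha> (x + y) v = \<alpha> x v + \<alpha> y v"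
    if "x \<in> dp_space n" "y \<in> dp_space n" "v \<in> V" for x y v
    using that linear by simp
  have \<alpha>_mult: "\<alpha> (dp_mult n (dp_mult n x q) y) v = \<alpha> x (\<alpha> y v)"
    and \<alpha>_\<beta>: "s 2 (\<alpha> x (\<beta> y v)) = \<beta> (dp_mult n (dp_mult n x q) y) v + \<beta> y (\<alpha> x v)"
    and \<alpha>_bracket: "s 2 (\<alpha> (zass_bracket n x y) v) = \<beta> x (\<alpha> y v) - \<beta> y (\<alpha> x v)"
    if "x \<in> dp_space n" "y \<in> dp_space n" "v \<in> V" for x y v
    using bspec[OF bspec[OF bspec[OF relations that(1)] that(2)] that(3)] by simp_all
  \<comment> \<open>Here p > 2 enters: the factors 2 in both compatibility relations can be
    cancelled.\<close>
  have two: "(2::'k) \<noteq> 0"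
    using CHAR of_nat_eq_0_iff_char_dvd[of 2, where 'a = 'k] by (auto dest: dvd_imp_le)
  have s2: "s 2 v = v + v" for v
    using scale_left_distrib[of 1 1 v] by simp
  have double_inj: "u = v" if "u + u = v + v" for u v :: 'v
    using that two by (simp flip: s2)
  have zero_in: "0 \<in> V"
    using vs(2) by (rule subspace_0)
  have zero_at: "\<alpha> x 0 = 0" "\<beta> x 0 = 0" if "x \<in> dp_space n" for x
    using \<alpha>_add[OF that zero_in zero_in] \<beta>_add[OF that zero_in zero_in] by simp_all
  have unit: "dp_mult n (dp_mult n r q) x = x" "dp_mult n (dp_mult n x q) r = x"
    if "x \<in> dp_space n" for x
    using dp_mult_unit[OF that] r
    by (simp_all add: dp_mult_comm[of n r q] dp_mult_assoc[of n x q r] dp_mult_comm[of n x "dp_basis n 0"])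

  txt \<open>\<open>r\<close> is the unit of \<open>\<bullet>\<^sub>q\<close>, so \<open>\<alpha> r\<close> is an idempotent through which the whole action factors.\<close>
  have \<alpha>_r: "\<alpha> x (\<alpha> r v) = \<alpha> x v" "\<alpha> r (\<alpha> x v) = \<alpha> x v" if "x \<in> dp_space n" "v \<in> V" for x v
    using that r \<alpha>_mult[of x r v] \<alpha>_mult[of r x v] by (simp_all add: unit)
  have \<beta>_r: "\<beta> y (\<alpha> r v) = \<beta> y v" if y: "y \<in> dp_space n" and v: "v \<in> V" for y v
  proof -
    \<comment> \<open>Write E for \<open>\<alpha> r\<close> and b for \<open>\<beta> y\<close>, so
      that 2Eb = b + bE. Composing with E on the left gives Eb = EbE, on the right EbE = bE; hence
      2bE = b + bE.\<close>
    have 1: "\<alpha> r (\<beta> y u) + \<alpha> r (\<beta> y u) = \<beta> y u + \<beta> y (\<alpha> r u)" if "u \<in> V" for u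
      using \<alpha>_\<beta>[of r y u] y r that by (simp add: unit s2)
    have "\<alpha> r (\<alpha> r (\<beta> y v) + \<alpha> r (\<beta> y v)) = \<alpha> r (\<beta> y v + \<beta> y (\<alpha> r v))"
      using 1[OF v] by simp
    then have 2: "\<alpha> r (\<beta> y v) = \<alpha> r (\<beta> y (\<alpha> r v))"
      using r y v by (simp add: \<alpha>_add \<alpha>_in \<beta>_in \<alpha>_r)
    have "\<alpha> r (\<beta> y (\<alpha> r v)) + \<alpha> r (\<beta> y (\<alpha> r v)) = \<beta> y (\<alpha> r v) + \<beta> y (\<alpha> r v)"
      using 1[of "\<alpha> r v"] r y v by (simp add: \<alpha>_in \<alpha>_r)
    then have "\<alpha> r (\<beta> y (\<alpha> r v)) = \<beta> y (\<alpha> r v)"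
      by (rule double_inj)
    with 1[OF v] 2 show ?thesis by simp
  qed
  \<comment> \<open>Since \<alpha> and \<beta> factor through \<open>\<alpha> r\<close>, they vanish
    on its kernel, which is therefore a subrepresentation.\<close>
  define U where "U = {v \<in> V. \<alpha> r v = 0}"
  have "is_subrep (zass_tpa n q) R U"
    unfolding is_subrep_def defs[symmetric]
  proof (intro conjI ballI)
    show "U \<subseteq> V" by (auto simp: U_def)
    show "subspace U"
      using vs(2) r by (auto simp: subspace_def U_def \<alpha>_add \<alpha>_scale zero_at)
    fix x u assume "x \<in> tpa_space (zass_tpa n q)" and u: "u \<in> U"
    then have x: "x \<in> dp_space n" by (simp add: zass_tpa_def)
    have "\<alpha> x u = 0" "\<beta> x u = 0"
      using \<alpha>_r(1)[OF x, of u] \<beta>_r[OF x, of u] u x by (auto simp: U_def zero_at)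
    then show "\<alpha> x u \<in> U" "\<beta> x u \<in> U"
      using r zero_in by (simp_all add: U_def zero_at)
  qed
  then consider "U = V" | "U = {0}"
    using irred by blast
  then show ?thesis
  proof cases
    case 1
    then have "\<alpha> r v = 0" if "v \<in> V" for v
      using that by (auto simp: U_def)
    then have trivial: "\<alpha> x v = 0" "\<beta> x v = 0" if "x \<in> dp_space n" "v \<in> V" for x v
      using \<alpha>_r(1)[OF that] \<beta>_r[OF that] that by (simp_all add: zero_at)
    obtain v where v: "v \<in> V" "v \<noteq> 0"
      using nz zero_in by blast
    \<comment> \<open>Under the zero action every subspace is a subrepresentation, so V must be a
      line.\<close>
    have "is_subrep (zass_tpa n q) R (span {v})"
      unfolding is_subrep_def defs[symmetric]
    proof (intro conjI ballI)
      show "span {v} \<subseteq> V"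
        using v vs(2) by (simp add: span_minimal)
      then show "\<alpha> x u \<in> span {v}" "\<beta> x u \<in> span {v}"
        if "x \<in> tpa_space (zass_tpa n q)" "u \<in> span {v}" for x u
        using that trivial[of x u] by (auto simp: zass_tpa_def span_zero)
    qed simp
    then have V: "V = span {v}"
      using irred[of "span {v}"] v span_base[of v "{v}"] by auto
    define \<psi> where "\<psi> c = s c v" for c
    have bij: "bij_betw \<psi> UNIV V"
      unfolding bij_betw_def V \<psi>_def using v by (auto simp: inj_on_def span_singleton)
    define \<phi> where "\<phi> = inv_into UNIV \<psi>"
    have \<phi>\<psi>: "\<phi> (\<psi> c) = c" for c
      using bij by (simp add: \<phi>_def bij_betw_def)
    have V_eq: "V = range \<psi>"
      using bij by (simp add: bij_betw_def)
    have \<psi>_add: "\<psi> c + \<psi> d = \<psi> (c + d)" and \<psi>_scale: "s c (\<psi> d) = \<psi> (c * d)" for c d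
      by (simp_all add: \<psi>_def scale_left_distrib)
    have "\<phi> 0 = 0"
      using \<phi>\<psi>[of 0] by (simp add: \<psi>_def)
    then have "rep_iso (zass_tpa n q) R trivial_rep_1"
      unfolding rep_iso_def defs[symmetric]
    proof (intro exI[of _ \<phi>] conjI ballI)
      show "bij_betw \<phi> V (rep_space trivial_rep_1)"
        using bij_betw_inv_into[OF bij] by (simp add: \<phi>_def trivial_rep_1_def)
      show "lin_on s V (rep_scale trivial_rep_1) (rep_space trivial_rep_1) \<phi>"
        by (auto simp: trivial_rep_1_def lin_on_def V_eq \<phi>\<psi> \<psi>_add \<psi>_scale)
    qed (simp_all add: trivial trivial_rep_1_def zass_tpa_def)
    then show ?thesis ..
  next
    case 2
    have \<alpha>_r_id: "\<alpha> r v = v" if v: "v \<in> V" for v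
    proof -
      \<comment> \<open>Idempotence puts v - \<open>\<alpha> r v\<close> into the zero kernel
        U.\<close>
      have "\<alpha> r (v + s (-1) (\<alpha> r v)) = 0"
        using v r vs by (simp only: \<alpha>_add \<alpha>_scale \<alpha>_in \<alpha>_r subspace_scale) simp
      then have "v - \<alpha> r v \<in> U"
        using v r vs by (simp add: U_def \<alpha>_in subspace_diff)
      with 2 show ?thesis by simp
    qed
    \<comment> \<open>The factor r cancels the q in the product: (f r) q (g r) = (f g) r. So A is
      multiplicative for the ordinary product of \<O>(1;n).\<close>
    define A where "A f = \<alpha> (dp_mult n f r)" for f
    define B where "B = \<beta> (dp_basis n 0)"
    have A_mult: "A (dp_mult n f g) v = A f (A g v)"
      if "f \<in> dp_space n" "g \<in> dp_space n" "v \<in> V" for f g v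
    proof -
      have "dp_mult n (dp_mult n (dp_mult n f r) q) (dp_mult n g r) = dp_mult n (dp_mult n f g) r"
        using unit(1)[of "dp_mult n (dp_mult n f g) r"] by (simp add: dp_mult_ac)
      then show ?thesis
        using \<alpha>_mult[of "dp_mult n f r" "dp_mult n g r" v] that by (simp add: A_def)
    qed
    have \<alpha>_eq_A: "\<alpha> x v = A (dp_mult n x q) v" if "x \<in> dp_space n" "v \<in> V" for x v
      using unit[OF that(1)] by (simp add: A_def)
    have \<beta>_mult: "\<beta> (dp_mult n f g) v = A f (\<beta> g v) + A f (\<beta> g v) - \<beta> g (A f v)"
      if "f \<in> dp_space n" "g \<in> dp_space n" "v \<in> V" for f g v
    proof -
      have "dp_mult n (dp_mult n (dp_mult n f r) q) g = dp_mult n f g"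
        using unit(1)[of "dp_mult n f g"] by (simp add: dp_mult_ac)
      then show ?thesis
        using \<alpha>_\<beta>[of "dp_mult n f r" g v] that by (simp add: A_def s2 algebra_simps)
    qed
    \<comment> \<open>Taking g = \<partial>, the unit, shows that A and B determine \<beta>.\<close>
    have \<beta>_eq: "\<beta> x v = A x (B v) + A x (B v) - B (A x v)" if "x \<in> dp_space n" "v \<in> V" for x v
      using \<beta>_mult[of x "dp_basis n 0" v] that dp_mult_unit[OF that(1)]
      by (simp add: B_def dp_mult_comm[of n x])
    have unit_deriv: "dp_deriv (dp_basis n 0) = (0 :: 'k dp)"
      using CHAR by (simp add: dp_deriv_basis)
    have B_A: "B (A f v) = A f (B v) + A (dp_deriv f) v" if f: "f \<in> dp_space n" and v: "v \<in> V" for f v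
    proof -
      \<comment> \<open>This u is \<open>A r v\<close>, chosen so that
        \<open>\<alpha> x u = A x v\<close>. The bracket relation for \<partial> and f, applied to
        u, then reads 2 A(f') v = B A(f) v - \<open>\<beta> f v\<close>, and
        \<open>\<beta>_eq\<close> makes the right side twice the commutator.\<close>
      define u where "u = \<alpha> (dp_mult n r r) v"
      have u: "u \<in> V"
        using v by (simp add: u_def \<alpha>_in)
      have \<alpha>_u: "\<alpha> x u = A x v" if "x \<in> dp_space n" for x
      proof -
        have "dp_mult n (dp_mult n x q) (dp_mult n r r) = dp_mult n x r"
          using unit(1)[of "dp_mult n x r"] by (simp add: dp_mult_ac)
        then show ?thesis
          using \<alpha>_mult[of x "dp_mult n r r" v] that v by (simp add: A_def u_def)
      qed
      have "A (dp_basis n 0) v = v"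
        using dp_mult_unit[OF r(1)] \<alpha>_r_id[OF v] by (simp add: A_def)
      then have \<alpha>_1_u: "\<alpha> (dp_basis n 0) u = v"
        by (simp add: \<alpha>_u)
      have "zass_bracket n (dp_basis n 0) f = dp_deriv f"
        using f dp_mult_unit[of "dp_deriv f" n]
        by (simp add: zass_bracket_def unit_deriv) (simp add: dp_mult_nth fun_eq_iff)
      then have "A (dp_deriv f) v + A (dp_deriv f) v = B (A f v) - \<beta> f v"
        using \<alpha>_bracket[of "dp_basis n 0" f u] f u by (simp add: \<alpha>_u \<alpha>_1_u s2 B_def)
      also have "\<dots> = (B (A f v) - A f (B v)) + (B (A f v) - A f (B v))"
        using f v by (simp add: \<beta>_eq)
      finally have "A (dp_deriv f) v = B (A f v) - A f (B v)"
        by (rule double_inj)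
      then show ?thesis by simp
    qed
    interpret dp_differential_module s n V A B
    proof
      show "CHAR('k) > 0" using CHAR by simp
      show "A (dp_basis n 0) v = v" if "v \<in> V" for v
        using dp_mult_unit[OF r(1)] \<alpha>_r_id[OF that] by (simp add: A_def)
    qed (use vs in \<open>simp_all add: A_mult B_A\<close>,
         simp_all add: A_def B_def \<alpha>_in \<beta>_in \<alpha>_add \<beta>_add \<alpha>_scale \<beta>_scale \<alpha>_add_left \<alpha>_scale_left
           dp_mult_linear)
    have \<beta>_eq': "\<beta> x v = A x (B v) - A (dp_deriv x) v" if "x \<in> dp_space n" "v \<in> V" for x v
      using that by (simp add: \<beta>_eq B_A)
    obtain F where F: "finite F" "span F = V"
      using fin by (auto simp: fin_dim_rep_def defs)
    obtain a w where a: "a \<in> dp_space n" and w: "w \<in> V" and Bw: "B w = A a w"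
      and bij: "bij_betw (\<lambda>f. A f w) (dp_space n) V"
    proof (rule irreducible_structure[OF nz F(1)])
      fix U assume U: "U \<subseteq> V" "subspace U"
        and A_U: "\<And>f u. f \<in> dp_space n \<Longrightarrow> u \<in> U \<Longrightarrow> A f u \<in> U"
        and B_U: "\<And>u. u \<in> U \<Longrightarrow> B u \<in> U"
      \<comment> \<open>Both actions are expressed by A and B, so stability under these two
        suffices.\<close>
      have "\<alpha> x u \<in> U \<and> \<beta> x u \<in> U" if "x \<in> dp_space n" "u \<in> U" for x u
        using that U by (auto simp: \<alpha>_eq_A \<beta>_eq' subset_iff intro!: A_U B_U subspace_diff)
      then have "is_subrep (zass_tpa n q) R U"
        using U by (simp add: is_subrep_def zass_tpa_def flip: defs)
      then show "U = {0} \<or> U = V" by (rule irred)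
    qed (use F in auto)
    define \<psi> where "\<psi> f = A f w" for f
    define \<phi> where "\<phi> = inv_into (dp_space n) \<psi>"
    have bij: "bij_betw \<psi> (dp_space n) V"
      using bij by (simp add: \<psi>_def[abs_def])
    have \<phi>\<psi>: "\<phi> (\<psi> f) = f" if "f \<in> dp_space n" for f
      using bij that by (simp add: \<phi>_def bij_betw_def)
    have V_eq: "V = \<psi> ` dp_space n"
      using bij by (simp add: bij_betw_def)
    have \<psi>_add: "\<psi> f + \<psi> g = \<psi> (f + g)" and \<psi>_scale: "s c (\<psi> f) = \<psi> (dp_scale c f)"
      if "f \<in> dp_space n" "g \<in> dp_space n" for f g c
      using that w by (simp_all add: \<psi>_def A_add_left A_scale_left)
    have \<alpha>_\<psi>: "\<alpha> x (\<psi> f) = \<psi> (dp_mult n (dp_mult n x q) f)"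
      if "x \<in> dp_space n" "f \<in> dp_space n" for x f
      using that w by (simp add: \<psi>_def A_in \<alpha>_eq_A A_mult)
    have \<beta>_\<psi>: "\<beta> x (\<psi> f) = \<psi> (zass_bracket n x f + dp_mult n (dp_mult n x a) f)"
      if x: "x \<in> dp_space n" and f: "f \<in> dp_space n" for x f
    proof -
      \<comment> \<open>The term with x' f stands on the left so that additivity of \<psi> suffices.
        The rest matches x f' - x' f + x a f, the action in \<open>zass_rep n q a\<close>.\<close>
      have "\<beta> x (\<psi> f) + \<psi> (dp_mult n (dp_deriv x) f) = A x (A f (A a w) + A (dp_deriv f) w)"
        using x f w by (simp add: \<psi>_def A_in \<beta>_eq' B_A Bw A_mult)
      also have "\<dots> = \<psi> (dp_mult n x (dp_mult n f a) + dp_mult n x (dp_deriv f))"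
        using x f w a by (simp add: \<psi>_def A_add A_add_left A_mult A_in)
      also have "dp_mult n x (dp_mult n f a) + dp_mult n x (dp_deriv f) =
          (zass_bracket n x f + dp_mult n (dp_mult n x a) f) + dp_mult n (dp_deriv x) f"
        by (simp add: zass_bracket_def dp_mult_ac)
      also have "\<psi> \<dots> = \<psi> (zass_bracket n x f + dp_mult n (dp_mult n x a) f) + \<psi> (dp_mult n (dp_deriv x) f)"
        using x f by (intro \<psi>_add[symmetric]) simp_all
      finally show ?thesis by simp
    qed
    have "rep_iso (zass_tpa n q) R (zass_rep n q a)"
      unfolding rep_iso_def defs[symmetric]
    proof (intro exI[of _ \<phi>] conjI ballI)
      show "bij_betw \<phi> V (rep_space (zass_rep n q a))"
        using bij_betw_inv_into[OF bij] by (simp add: \<phi>_def zass_rep_def)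
      show "lin_on s V (rep_scale (zass_rep n q a)) (rep_space (zass_rep n q a)) \<phi>"
        by (auto simp: zass_rep_def lin_on_def V_eq \<phi>\<psi> \<psi>_add \<psi>_scale)
      fix x v assume "x \<in> tpa_space (zass_tpa n q)" "v \<in> V"
      then obtain f where f: "v = \<psi> f" "f \<in> dp_space n" and x: "x \<in> dp_space n"
        by (auto simp: zass_tpa_def V_eq)
      show "\<phi> (\<alpha> x v) = rep_alpha (zass_rep n q a) x (\<phi> v)"
        using f x by (simp add: zass_rep_def \<alpha>_\<psi> \<phi>\<psi>)
      show "\<phi> (\<beta> x v) = rep_beta (zass_rep n q a) x (\<phi> v)"
        using f x by (simp add: zass_rep_def \<beta>_\<psi> \<phi>\<psi>)
    qed
    with a show ?thesis by blast
  qed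
qed

theorem theorem5p15:
  fixes q :: "'k::alg_closed_field dp" and n p :: nat
  assumes "CHAR('k) = p" and "p > 2" and "n \<ge> 1"
    and "q \<in> dp_space n" and "dp_invertible n q"
  shows "(\<forall>R :: ('k, 'k dp, 'v::ab_group_add) repn.
            irreducible_rep (zass_tpa n q) R \<and> fin_dim_rep R \<longrightarrow>
              rep_iso (zass_tpa n q) R trivial_rep_1 \<or>
              (\<exists>a\<in>dp_space n. rep_iso (zass_tpa n q) R (zass_rep n q a)))
         \<and> (\<forall>a\<in>dp_space n. rep_dim (zass_rep n q a) = p ^ n)"
  using assms irreducible_zass_rep[of q n] dp_space_dim[of n, where 'k = 'k]
  by (auto simp: rep_dim_def zass_rep_def)

end
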